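(* There are no constants $0<\nu<1$ and $c>0$ such that the inequality $$ \mathsf{d}_{\star}(A+A)\ge c\,\bigl(\mathsf{d}^{\star}(A+A)\bigr)^{1-\nu}\,\mathsf{d}(A)^{\nu} $$ holds for all sets $A\subseteq\mathbb{N}$ which admit asymptotic density.
   Context: Here $\mathbb{N}=\{0,1,2,\ldots\}$. For $A\subseteq\mathbb{N}$, the lower and upper asymptotic densities are $$\mathsf{d}_{\star}(A)=\liminf_{N\to\infty}\frac{|A\cap[0,N)|}{N},\qquad \mathsf{d}^{\star}(A)=\limsup_{N\to\infty}\frac{|A\cap[0,N)|}{N}.$$ If $\mathsf{d}_{\star}(A)=\mathsf{d}^{\star}(A)$, then $A$ is said to admit asymptotic density, and the common value is denoted by $\mathsf{d}(A)$. The sumset is $A+A=\{x+y: x\in A,\ y\in A\}$. *)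

theory Defs
  imports "HOL-Analysis.Analysis" "HOL-Library.Set_Algebras"
begin

text \<open>
  The term at \<open>N = 0\<close> is \<open>0 / 0 = 0\<close>, which does not affect limits. The counting ratios lie in
  \<open>[0, 1]\<close>, so the limits inferior and superior, taken in the complete lattice \<open>ereal\<close>, are finite and
  the conversion back to \<open>real\<close> loses nothing (lemmas \<open>ereal_lower_dens\<close> and \<open>ereal_upper_dens\<close>).
\<close>

definition counting_ratio :: "nat set \<Rightarrow> nat \<Rightarrow> real" where
  "counting_ratio A N = real (card (A \<inter> {0..<N})) / real N"

definition lower_dens :: "nat set \<Rightarrow> real" where
  "lower_dens A = real_of_ereal (liminf (\<lambda>N. ereal (counting_ratio A N)))"

definition upper_dens :: "nat set \<Rightarrow> real" where
  "upper_dens A = real_of_ereal (limsup (\<lambda>N. ereal (counting_ratio A N)))"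

definition admits_dens :: "nat set \<Rightarrow> bool" where
  "admits_dens A \<longleftrightarrow> lower_dens A = upper_dens A"

text \<open>Only meaningful for sets \<open>A\<close> with \<open>admits_dens A\<close>.\<close>

definition asymp_dens :: "nat set \<Rightarrow> real" where
  "asymp_dens A = (THE d. lower_dens A = d \<and> upper_dens A = d)"

lemma counting_ratio_bounds: "0 \<le> counting_ratio A N" "counting_ratio A N \<le> 1"
proof -
  have "card (A \<inter> {0..<N}) \<le> card {0..<N}"
    by (intro card_mono) auto
  then show "0 \<le> counting_ratio A N" "counting_ratio A N \<le> 1"
    by (auto simp: counting_ratio_def divide_le_eq_1)
qed

lemma ereal_lower_dens: "ereal (lower_dens A) = liminf (\<lambda>N. ereal (counting_ratio A N))"
proof -
  let ?L = "liminf (\<lambda>N. ereal (counting_ratio A N))"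
  have "0 \<le> ?L"
    by (intro Liminf_bounded always_eventually) (simp add: counting_ratio_bounds)
  moreover have "?L \<le> limsup (\<lambda>N. ereal (counting_ratio A N))"
    by (intro Liminf_le_Limsup) simp
  moreover have "limsup (\<lambda>N. ereal (counting_ratio A N)) \<le> 1"
    by (intro Limsup_bounded always_eventually) (simp add: counting_ratio_bounds)
  ultimately have "\<bar>?L\<bar> \<noteq> \<infinity>" by auto
  then show ?thesis by (simp add: lower_dens_def ereal_real)
qed

lemma ereal_upper_dens: "ereal (upper_dens A) = limsup (\<lambda>N. ereal (counting_ratio A N))"
proof -
  let ?L = "limsup (\<lambda>N. ereal (counting_ratio A N))"
  have "0 \<le> liminf (\<lambda>N. ereal (counting_ratio A N))"
    by (intro Liminf_bounded always_eventually) (simp add: counting_ratio_bounds)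
  moreover have "liminf (\<lambda>N. ereal (counting_ratio A N)) \<le> ?L"
    by (intro Liminf_le_Limsup) simp
  moreover have "?L \<le> 1"
    by (intro Limsup_bounded always_eventually) (simp add: counting_ratio_bounds)
  ultimately have "\<bar>?L\<bar> \<noteq> \<infinity>" by auto
  then show ?thesis by (simp add: upper_dens_def ereal_real)
qed

lemma asymp_dens_eq:
  assumes "admits_dens A"
  shows "asymp_dens A = lower_dens A" "asymp_dens A = upper_dens A"
  using assms by (simp_all add: asymp_dens_def admits_dens_def)

end

theory Submission
  imports Defs
begin

text \<open>
  Fix a base \<open>s\<close> and a number \<open>d\<close>. The inequality is violated by a set \<open>A\<close> of density \<open>s\<^sup>-\<^sup>d\<close> whose
  sumset has upper density at least \<open>1/2\<close> but lower density at most \<open>s\<^sup>2 (3/s)\<^sup>d\<close>. Up to the factor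
  \<open>s\<^sup>2 3\<^sup>d\<close>, the lower density of \<open>A + A\<close> is thus as small as the density of \<open>A\<close>. Given \<open>\<nu> < 1\<close> and
  \<open>c > 0\<close>, choosing \<open>s\<close> with \<open>s\<^sup>1\<^sup>-\<^sup>\<nu> \<ge> 6\<close> and then \<open>d\<close> large gives a contradiction.

  The set \<open>A\<close> is defined by zero conditions on base \<open>s\<close> digits that change from one block
  \<open>[s\<^bsup>r\<^sup>2+r\<^esup>, s\<^bsup>(r+1)\<^sup>2+r+1\<^esup>)\<close> to the next. In an ordinary block the digits at the \<open>d\<close> positions \<open>j\<^sup>2\<close> with
  \<open>r - d < j \<le> r\<close> vanish; in a reset block, which occurs when \<open>d + 1\<close> divides \<open>r\<close>, the \<open>d\<close> lowest digits
  vanish.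

  \<^item> Every block imposes \<open>d\<close> conditions, whose period is negligible compared with the elements of the
    block, so \<open>A\<close> has density \<open>s\<^sup>-\<^sup>d\<close> (\<open>counting_ratio_resetting_set_tendsto\<close>).

  \<^item> A reset block consists of the multiples of \<open>s\<^sup>d\<close>, while the ordinary block before it meets every
    residue class modulo \<open>s\<^sup>d\<close>. Together they represent almost everything up to the end of the reset
    block (\<open>upper_dens_sumset_resetting_set\<close>).

  \<^item> Let \<open>R\<close> be a reset index, and consider the \<open>d\<close> positions \<open>j\<^sup>2\<close> with \<open>R < j \<le> R + d\<close>. An element of \<open>A\<close>
    in block \<open>r \<le> R + d\<close> has the digit \<open>0\<close> at each of them except possibly one: those with \<open>j \<le> r\<close> are
    covered by the conditions of the block, those with \<open>j \<ge> r + 2\<close> exceed the length of the number,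
    and only \<open>j = r + 1\<close> remains (\<open>card_nonzero_digits_le_1\<close>). Hence an element of \<open>A + A\<close> below the end
    of block \<open>R + d\<close> has, up to two exceptions, only the digits \<open>0\<close> and \<open>1\<close> (a carry) at these
    positions. Such numbers are rare (\<open>card_few_large_digits\<close>).
\<close>

section \<open>Digits in a fixed base\<close>

text \<open>The base \<open>s\<close> digit of \<open>n\<close> at the position with place value \<open>s ^ p\<close>.\<close>

definition digit :: "nat \<Rightarrow> nat \<Rightarrow> nat \<Rightarrow> nat" where
  "digit s p n = n div s ^ p mod s"

lemma digit_eq_0_if_less: "n < s ^ p \<Longrightarrow> digit s p n = 0"
  by (simp add: digit_def)

lemma digit_add_mult_power:
  assumes "p < L"
  shows "digit s p (n + k * s ^ L) = digit s p n"
proof (cases "s = 0")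
  case True
  with assms show ?thesis by (simp add: power_0_left)
next
  case False
  obtain e where L: "L = p + Suc e"
    using assms less_imp_Suc_add by auto
  have multiple: "k * s ^ L = s ^ p * (s * (k * s ^ e))"
    by (simp add: L power_add)
  have "(n + k * s ^ L) div s ^ p = n div s ^ p + s * (k * s ^ e)"
    unfolding multiple using False by simp
  then show ?thesis
    by (simp add: digit_def)
qed

lemma digit_eq_0_if_dvd: "p < L \<Longrightarrow> s ^ L dvd n \<Longrightarrow> digit s p n = 0"
  using digit_add_mult_power[of p L s 0] by (auto simp: digit_def elim!: dvdE simp: mult.commute)

lemma digit_power_mult_add:
  assumes "n < s ^ L" "t < s"
  shows "digit s L (n + t * s ^ L) = t"
  using assms by (simp add: digit_def)

text \<open>Where both summands have the digit \<open>0\<close>, the sum can only have the carry from the lower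
  positions.\<close>

lemma digit_add_le_1:
  assumes s: "0 < s" and "digit s p a = 0" "digit s p b = 0"
  shows "digit s p (a + b) \<le> 1"
proof -
  define P where "P = s ^ p"
  have P: "0 < P" using s by (simp add: P_def)
  obtain u where u: "a div P = s * u"
    using assms(2) by (auto simp: digit_def P_def elim: dvdE)
  obtain v where v: "b div P = s * v"
    using assms(3) by (auto simp: digit_def P_def elim: dvdE)
  have carry: "(a mod P + b mod P) div P \<le> 1"
  proof -
    have "a mod P + b mod P < 2 * P"
      using mod_less_divisor[OF P, of a] mod_less_divisor[OF P, of b] by linarith
    then show ?thesis
      using less_mult_imp_div_less[of "a mod P + b mod P" 2 P] by simp
  qed
  have "(a + b) div P = s * (u + v) + (a mod P + b mod P) div P"
    using div_add1_eq[of a b P] u v by (simp add: algebra_simps)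
  then have "digit s p (a + b) = ((a mod P + b mod P) div P) mod s"
    by (simp add: digit_def flip: P_def)
  also have "\<dots> \<le> (a mod P + b mod P) div P"
    by (rule mod_less_eq_dividend)
  finally show ?thesis using carry by linarith
qed

text \<open>The digits of a uniformly distributed \<open>n < s ^ L\<close> are independent and uniform, stated here
  without normalisation.\<close>

lemma sum_prod_digits:
  fixes f :: "nat \<Rightarrow> nat \<Rightarrow> real"
  shows "(\<Sum>n<s ^ L. \<Prod>p<L. f p (digit s p n)) = (\<Prod>p<L. \<Sum>t<s. f p t)"
proof (induction L)
  case 0
  then show ?case by simp
next
  case (Suc L)
  let ?g = "\<lambda>n. \<Prod>p<L. f p (digit s p n)"
  have "(\<Sum>n<s ^ Suc L. \<Prod>p<Suc L. f p (digit s p n))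
      = (\<Sum>t<s. \<Sum>n\<in>{t * s ^ L..<t * s ^ L + s ^ L}. \<Prod>p<Suc L. f p (digit s p n))"
    by (simp add: sum.nat_group)
  also have "\<dots> = (\<Sum>t<s. \<Sum>n<s ^ L. ?g n * f L t)"
  proof (rule sum.cong[OF refl])
    fix t assume "t \<in> {..<s}"
    then have t: "t < s" by simp
    have "(\<Sum>n\<in>{t * s ^ L..<t * s ^ L + s ^ L}. \<Prod>p<Suc L. f p (digit s p n))
        = (\<Sum>n<s ^ L. \<Prod>p<Suc L. f p (digit s p (n + t * s ^ L)))"
      using sum.shift_bounds_nat_ivl[of _ 0 "t * s ^ L" "s ^ L"]
      by (simp add: atLeast0LessThan add.commute)
    also have "\<dots> = (\<Sum>n<s ^ L. ?g n * f L t)"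
      using t by (intro sum.cong) (simp_all add: digit_power_mult_add digit_add_mult_power)
    finally show "(\<Sum>n\<in>{t * s ^ L..<t * s ^ L + s ^ L}. \<Prod>p<Suc L. f p (digit s p n))
        = (\<Sum>n<s ^ L. ?g n * f L t)" .
  qed
  also have "\<dots> = (\<Sum>n<s ^ L. ?g n) * (\<Sum>t<s. f L t)"
    by (simp flip: sum_distrib_left sum_distrib_right)
  finally show ?case
    using Suc.IH by simp
qed

corollary sum_prod_digits_subset:
  fixes f :: "nat \<Rightarrow> real"
  assumes "I \<subseteq> {..<L}"
  shows "(\<Sum>n<s ^ L. \<Prod>p\<in>I. f (digit s p n)) = real s ^ (L - card I) * (\<Sum>t<s. f t) ^ card I"
proof -
  have fin: "finite I" using assms finite_subset by blast
  have restrict: "(\<Prod>p<L. if p \<in> I then h p else 1) = (\<Prod>p\<in>I. h p)" for h :: "nat \<Rightarrow> real"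
    using assms by (simp add: prod.If_cases Int_absorb1)
  have "(\<Sum>n<s ^ L. \<Prod>p\<in>I. f (digit s p n))
      = (\<Sum>n<s ^ L. \<Prod>p<L. (\<lambda>p t. if p \<in> I then f t else 1) p (digit s p n))"
    by (simp add: restrict)
  also have "\<dots> = (\<Prod>p<L. \<Sum>t<s. if p \<in> I then f t else 1)"
    by (rule sum_prod_digits)
  also have "\<dots> = (\<Prod>p<L. if p \<in> I then \<Sum>t<s. f t else real s)"
    by (intro prod.cong) auto
  also have "\<dots> = (\<Sum>t<s. f t) ^ card I * real s ^ card ({..<L} - I)"
    using assms by (simp add: prod.If_cases Int_absorb1 Diff_eq)
  also have "card ({..<L} - I) = L - card I"
    using fin assms by (simp add: card_Diff_subset)
  finally show ?thesis by simp
qed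

section \<open>Integers with prescribed zero digits\<close>

text \<open>The numbers whose base \<open>s\<close> digits vanish at all positions in \<open>I\<close>; for \<open>I \<subseteq> {..<L}\<close> this set has
  period \<open>s ^ L\<close>.\<close>

definition zero_digits :: "nat \<Rightarrow> nat set \<Rightarrow> nat set" where
  "zero_digits s I = {n. \<forall>p\<in>I. digit s p n = 0}"

lemma card_zero_digits_power:
  assumes "0 < s" "I \<subseteq> {..<L}"
  shows "card (zero_digits s I \<inter> {..<s ^ L}) = s ^ (L - card I)"
proof -
  have fin: "finite I" using assms finite_subset by blast
  have "real (card (zero_digits s I \<inter> {..<s ^ L}))
      = (\<Sum>n<s ^ L. if n \<in> zero_digits s I then 1 else 0)"
    by (simp add: sum.If_cases Int_commute)
  also have "\<dots> = (\<Sum>n<s ^ L. \<Prod>p\<in>I. if digit s p n = 0 then 1 else 0)"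
    using fin by (intro sum.cong) (auto simp: zero_digits_def)
  also have "\<dots> = real s ^ (L - card I) * (\<Sum>t<s. if t = 0 then 1 else 0) ^ card I"
    by (rule sum_prod_digits_subset[OF assms(2)])
  also have "\<dots> = real (s ^ (L - card I))"
    using assms(1) by simp
  finally show ?thesis by linarith
qed

lemma card_zero_digits_multiple:
  assumes "0 < s" "I \<subseteq> {..<L}"
  shows "card (zero_digits s I \<inter> {..<q * s ^ L}) = q * s ^ (L - card I)"
proof (induction q)
  case 0
  then show ?case by simp
next
  case (Suc q)
  let ?Z = "zero_digits s I"
  have periodic: "n + q * s ^ L \<in> ?Z \<longleftrightarrow> n \<in> ?Z" for n
    using assms(2) by (auto simp: zero_digits_def digit_add_mult_power subset_iff)
  have shift: "?Z \<inter> {q * s ^ L..<Suc q * s ^ L} = (\<lambda>n. n + q * s ^ L) ` (?Z \<inter> {..<s ^ L})"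
  proof (intro set_eqI iffI)
    fix n assume n: "n \<in> ?Z \<inter> {q * s ^ L..<Suc q * s ^ L}"
    define n' where "n' = n - q * s ^ L"
    have n': "n = n' + q * s ^ L" "n' < s ^ L"
      using n by (auto simp: n'_def)
    then have "n' \<in> ?Z"
      using n periodic[of n'] by simp
    then show "n \<in> (\<lambda>n. n + q * s ^ L) ` (?Z \<inter> {..<s ^ L})"
      using n' by blast
  next
    fix n assume "n \<in> (\<lambda>n. n + q * s ^ L) ` (?Z \<inter> {..<s ^ L})"
    then obtain n' where "n = n' + q * s ^ L" "n' \<in> ?Z" "n' < s ^ L"
      by blast
    then show "n \<in> ?Z \<inter> {q * s ^ L..<Suc q * s ^ L}"
      using periodic[of n'] by simp
  qed
  have "?Z \<inter> {..<Suc q * s ^ L} = (?Z \<inter> {..<q * s ^ L}) \<union> (?Z \<inter> {q * s ^ L..<Suc q * s ^ L})"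
    by auto
  then have "card (?Z \<inter> {..<Suc q * s ^ L})
      = card (?Z \<inter> {..<q * s ^ L}) + card (?Z \<inter> {q * s ^ L..<Suc q * s ^ L})"
    by (simp add: card_Un_disjoint disjoint_iff)
  also have "card (?Z \<inter> {q * s ^ L..<Suc q * s ^ L}) = s ^ (L - card I)"
    unfolding shift by (subst card_image) (auto simp: inj_on_def card_zero_digits_power[OF assms])
  finally show ?case using Suc.IH by simp
qed

lemma card_zero_digits_multiple_real:
  assumes "0 < s" "I \<subseteq> {..<L}" "s ^ L dvd N"
  shows "real (card (zero_digits s I \<inter> {..<N})) = real N / real s ^ card I"
proof -
  obtain q where q: "N = q * s ^ L"
    using assms(3) by (metis dvdE mult.commute)
  have "card I \<le> L"
    using card_mono[OF _ assms(2)] by simp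
  then have "real s ^ L = real s ^ (L - card I) * real s ^ card I"
    by (simp flip: power_add)
  then show ?thesis
    using assms(1) by (simp add: q card_zero_digits_multiple[OF assms(1,2)])
qed

lemma card_zero_digits_approx:
  assumes "0 < s" "I \<subseteq> {..<L}"
  shows "\<bar>real (card (zero_digits s I \<inter> {..<N})) - real N / real s ^ card I\<bar> \<le> real s ^ L"
proof -
  let ?c = "\<lambda>N. real (card (zero_digits s I \<inter> {..<N}))" and ?m = "real s ^ card I"
  define N0 where "N0 = N div s ^ L * s ^ L"
  have sL: "0 < s ^ L" using assms(1) by simp
  have N0: "N0 \<le> N" "N < N0 + s ^ L"
    using dividend_less_div_times[OF sL, of N] by (auto simp: N0_def)
  have "?c N0 \<le> ?c N" "?c N \<le> ?c (N0 + s ^ L)"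
    using N0 by (auto intro!: card_mono)
  moreover have "?c N0 = real N0 / ?m" "?c (N0 + s ^ L) = real (N0 + s ^ L) / ?m"
    by (intro card_zero_digits_multiple_real[OF assms]; simp add: N0_def)+
  moreover have "real N0 / ?m \<le> real N / ?m" "real N / ?m \<le> real (N0 + s ^ L) / ?m"
    using N0 by (auto intro!: divide_right_mono simp del: of_nat_add)
  moreover have "real (N0 + s ^ L) / ?m \<le> real N0 / ?m + real s ^ L"
  proof -
    have "1 \<le> ?m" using assms(1) by simp
    then have "real s ^ L / ?m \<le> real s ^ L"
      by (simp add: divide_le_eq mult_left_le)
    then show ?thesis by (simp add: add_divide_distrib)
  qed
  ultimately show ?thesis by linarith
qed

text \<open>A Chernoff type bound: at the positions in \<open>I\<close>, give the weight \<open>1\<close> to the digits \<open>0\<close> and \<open>1\<close> and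
  the weight \<open>1 / s\<close> to all others. A number with at most two digits of the second kind has weight
  at least \<open>1 / s\<^sup>2\<close>, and the mean weight per digit is at most \<open>3 / s\<close>.\<close>

lemma card_few_large_digits:
  assumes s: "0 < s" and I: "I \<subseteq> {..<L}"
  shows "real (card {n \<in> {..<s ^ L}. card {p \<in> I. 1 < digit s p n} \<le> 2})
    \<le> real s ^ 2 * (3 / real s) ^ card I * real s ^ L"
proof -
  define f :: "nat \<Rightarrow> real" where "f t = (if 1 < t then 1 / real s else 1)" for t
  define E where "E = {n \<in> {..<s ^ L}. card {p \<in> I. 1 < digit s p n} \<le> 2}"
  have fin: "finite I" using I finite_subset by blast
  have f_nonneg: "0 \<le> f t" for t by (simp add: f_def)
  have prod_f: "(\<Prod>p\<in>I. f (digit s p n)) = (1 / real s) ^ card {p \<in> I. 1 < digit s p n}" for n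
    using fin by (simp add: f_def prod.If_cases Int_def)
  have "(\<Sum>t<s. f t) \<le> (\<Sum>t<s. (if t \<in> {..1} then 1 else 0) + 1 / real s)"
    by (intro sum_mono) (auto simp: f_def)
  also have "\<dots> = real (card ({..<s} \<inter> {..1})) + 1"
    using s by (simp add: sum.distrib sum.If_cases del: atMost_iff)
  also have "\<dots> \<le> 3"
    using card_mono[of "{..1::nat}" "{..<s} \<inter> {..1}"] by simp
  finally have sum_f: "(\<Sum>t<s. f t) \<le> 3" .
  have "real (card E) * (1 / real s) ^ 2 = (\<Sum>n\<in>E. (1 / real s) ^ 2)"
    by simp
  also have "\<dots> \<le> (\<Sum>n\<in>E. \<Prod>p\<in>I. f (digit s p n))"
    unfolding prod_f using s by (intro sum_mono power_decreasing) (auto simp: E_def)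
  also have "\<dots> \<le> (\<Sum>n<s ^ L. \<Prod>p\<in>I. f (digit s p n))"
    by (intro sum_mono2) (auto simp: E_def intro: prod_nonneg f_nonneg)
  also have "\<dots> = real s ^ (L - card I) * (\<Sum>t<s. f t) ^ card I"
    by (rule sum_prod_digits_subset[OF I])
  also have "\<dots> \<le> real s ^ (L - card I) * 3 ^ card I"
    by (intro mult_left_mono power_mono sum_f sum_nonneg f_nonneg) simp
  also have "\<dots> = (3 / real s) ^ card I * real s ^ L"
    using s card_mono[OF _ I] by (simp add: power_diff power_divide)
  finally have "real (card E) \<le> real s ^ 2 * (3 / real s) ^ card I * real s ^ L"
    using s by (simp add: field_simps)
  then show ?thesis
    by (simp only: E_def)
qed

section \<open>Bounds on densities from counting ratios\<close>

lemma lower_dens_le: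
  assumes "\<And>n. \<exists>N\<ge>n. counting_ratio A N \<le> x"
  shows "lower_dens A \<le> x"
proof (rule ccontr)
  assume "\<not> lower_dens A \<le> x"
  then have "ereal x < liminf (\<lambda>N. ereal (counting_ratio A N))"
    by (simp flip: ereal_lower_dens)
  then have "eventually (\<lambda>N. ereal x < ereal (counting_ratio A N)) sequentially"
    by (rule less_LiminfD)
  then obtain n where "\<And>N. n \<le> N \<Longrightarrow> x < counting_ratio A N"
    by (auto simp: eventually_sequentially)
  with assms[of n] show False by fastforce
qed

lemma le_upper_dens:
  assumes "\<And>n. \<exists>N\<ge>n. x \<le> counting_ratio A N"
  shows "x \<le> upper_dens A"
proof (rule ccontr)
  assume "\<not> x \<le> upper_dens A"
  then have "limsup (\<lambda>N. ereal (counting_ratio A N)) < ereal x"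
    by (simp flip: ereal_upper_dens)
  then have "eventually (\<lambda>N. ereal (counting_ratio A N) < ereal x) sequentially"
    by (rule Limsup_lessD)
  then obtain n where "\<And>N. n \<le> N \<Longrightarrow> counting_ratio A N < x"
    by (auto simp: eventually_sequentially)
  with assms[of n] show False by fastforce
qed

lemma dens_eq_if_tendsto:
  assumes "counting_ratio A \<longlonglongrightarrow> x"
  shows "lower_dens A = x" "upper_dens A = x"
proof -
  have "(\<lambda>N. ereal (counting_ratio A N)) \<longlonglongrightarrow> ereal x"
    using assms by simp
  from lim_imp_Liminf[OF _ this] lim_imp_Limsup[OF _ this]
  show "lower_dens A = x" "upper_dens A = x"
    by (simp_all add: lower_dens_def upper_dens_def)
qed

section \<open>The set of numbers with changing zero digits\<close>

text \<open>The positions of the digits that have to vanish in block \<open>r\<close>. The conditions are reset when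
  \<open>d + 1\<close> divides \<open>r\<close>. Only \<open>r \<ge> d\<close> matters, so the subtraction does not truncate.\<close>

definition zero_positions :: "nat \<Rightarrow> nat \<Rightarrow> nat set" where
  "zero_positions d r = (if Suc d dvd r then {..<d} else (\<lambda>j. j ^ 2) ` {r - d<..r})"

text \<open>The start of block \<open>r\<close>. The exponent exceeds \<open>r\<^sup>2\<close>, the highest position constrained in block \<open>r\<close>,
  by \<open>r\<close>, so that the period \<open>s ^ Suc (r ^ 2)\<close> is negligible in that block; and block \<open>r\<close> ends below
  \<open>s ^ (r + 2) ^ 2\<close>, so that its elements have the digit \<open>0\<close> at the positions \<open>j ^ 2\<close> with \<open>j \<ge> r + 2\<close>.\<close>

definition cutoff :: "nat \<Rightarrow> nat \<Rightarrow> nat" where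
  "cutoff s r = s ^ (r ^ 2 + r)"

definition block :: "nat \<Rightarrow> nat \<Rightarrow> nat set" where
  "block s r = {cutoff s r..<cutoff s (Suc r)}"

text \<open>The blocks \<open>r < d\<close> are left out, since there are fewer than \<open>d\<close> indices \<open>j\<close> with
  \<open>0 < j \<le> r\<close>.\<close>

definition resetting_set :: "nat \<Rightarrow> nat \<Rightarrow> nat set" where
  "resetting_set s d = (\<Union>r\<in>{d..}. block s r \<inter> zero_digits s (zero_positions d r))"

lemma card_zero_positions:
  assumes "d \<le> r"
  shows "card (zero_positions d r) = d"
proof -
  have "inj_on (\<lambda>j::nat. j ^ 2) {r - d<..r}"
    by (auto simp: inj_on_def)
  then show ?thesis
    using assms by (simp add: zero_positions_def card_image)
qed

lemma zero_positions_subset: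
  assumes "d \<le> r"
  shows "zero_positions d r \<subseteq> {..<Suc (r ^ 2)}"
proof -
  have "d \<le> r ^ 2"
    using assms le_square[of r] unfolding power2_eq_square by linarith
  then show ?thesis
    by (auto simp: zero_positions_def less_Suc_eq_le power_mono)
qed

lemma cutoff_Suc: "cutoff s (Suc r) = cutoff s r * s ^ (2 * r + 2)"
proof -
  have "(Suc r) ^ 2 + Suc r = (r ^ 2 + r) + (2 * r + 2)"
    by (simp add: power2_eq_square)
  then show ?thesis
    by (simp only: cutoff_def power_add)
qed

lemma strict_mono_cutoff:
  assumes "2 \<le> s"
  shows "strict_mono (cutoff s)"
  unfolding strict_mono_Suc_iff cutoff_def
  using assms by (intro allI power_strict_increasing) (simp_all add: power2_eq_square)

lemma le_cutoff:
  assumes "2 \<le> s"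
  shows "r \<le> cutoff s r"
  by (rule strict_mono_imp_increasing[OF strict_mono_cutoff[OF assms]])

lemma block_cover:
  assumes s: "2 \<le> s" and n: "cutoff s d \<le> n"
  shows "\<exists>r\<ge>d. n \<in> block s r"
proof -
  define r where "r = (LEAST r. n < cutoff s (Suc r))"
  have "n < cutoff s (Suc n)"
    using le_cutoff[OF s, of "Suc n"] by simp
  then have upper: "n < cutoff s (Suc r)"
    unfolding r_def by (rule LeastI)
  then have "cutoff s d < cutoff s (Suc r)"
    using n by simp
  then have "d \<le> r"
    using strict_mono_less[OF strict_mono_cutoff[OF s]] by simp
  moreover have "cutoff s r \<le> n"
  proof (cases r)
    case 0
    with \<open>d \<le> r\<close> n show ?thesis by simp
  next
    case (Suc r')
    then have "\<not> n < cutoff s (Suc r')"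
      using not_less_Least[of r' "\<lambda>r. n < cutoff s (Suc r)"] by (simp add: r_def)
    with Suc show ?thesis by simp
  qed
  ultimately show ?thesis
    using upper by (auto simp: block_def)
qed

lemma block_unique:
  assumes s: "2 \<le> s" and "n \<in> block s r" "n \<in> block s r'"
  shows "r = r'"
proof -
  have "cutoff s r < cutoff s (Suc r')" "cutoff s r' < cutoff s (Suc r)"
    using assms(2,3) by (auto simp: block_def)
  then show ?thesis
    using strict_mono_less[OF strict_mono_cutoff[OF s]] by simp
qed

lemma mem_resetting_set_block:
  assumes "2 \<le> s" "d \<le> r" "n \<in> block s r"
  shows "n \<in> resetting_set s d \<longleftrightarrow> n \<in> zero_digits s (zero_positions d r)"
  using assms block_unique by (auto simp: resetting_set_def)

lemma resetting_set_ge_cutoff: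
  assumes "2 \<le> s" "n \<in> resetting_set s d"
  shows "cutoff s d \<le> n"
proof -
  obtain r where "d \<le> r" "cutoff s r \<le> n"
    using assms(2) by (auto simp: resetting_set_def block_def)
  moreover from this have "cutoff s d \<le> cutoff s r"
    using strict_mono_less_eq[OF strict_mono_cutoff[OF assms(1)]] by simp
  ultimately show ?thesis by linarith
qed

section \<open>The set has a density\<close>

lemma card_resetting_set_step:
  assumes s: "2 \<le> s" and d: "1 \<le> d" "d \<le> r" and N: "cutoff s r \<le> N" "N \<le> cutoff s (Suc r)"
  shows "real (card (resetting_set s d \<inter> {..<N}))
    = real (card (resetting_set s d \<inter> {..<cutoff s r}))
      + (real (card (zero_digits s (zero_positions d r) \<inter> {..<N})) - real (cutoff s r) / real s ^ d)"
proof -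
  let ?A = "resetting_set s d" and ?Z = "zero_digits s (zero_positions d r)"
  have "?A \<inter> {..<N} = ?A \<inter> {..<cutoff s r} \<union> ?Z \<inter> {cutoff s r..<N}"
  proof (intro set_eqI)
    fix x
    show "x \<in> ?A \<inter> {..<N} \<longleftrightarrow> x \<in> ?A \<inter> {..<cutoff s r} \<union> ?Z \<inter> {cutoff s r..<N}"
      using N mem_resetting_set_block[OF s d(2), of x]
      by (cases "x < cutoff s r") (auto simp: block_def)
  qed
  then have A: "card (?A \<inter> {..<N}) = card (?A \<inter> {..<cutoff s r}) + card (?Z \<inter> {cutoff s r..<N})"
    by (simp add: card_Un_disjoint disjoint_iff)
  have "?Z \<inter> {..<N} = ?Z \<inter> {..<cutoff s r} \<union> ?Z \<inter> {cutoff s r..<N}"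
    using N by auto
  then have Z: "card (?Z \<inter> {..<N}) = card (?Z \<inter> {..<cutoff s r}) + card (?Z \<inter> {cutoff s r..<N})"
    by (simp add: card_Un_disjoint disjoint_iff)
  have "s ^ Suc (r ^ 2) dvd cutoff s r"
    unfolding cutoff_def using d by (intro le_imp_power_dvd) simp
  then have "real (card (?Z \<inter> {..<cutoff s r})) = real (cutoff s r) / real s ^ d"
    using card_zero_digits_multiple_real[OF _ zero_positions_subset[OF d(2)]] s
    by (simp add: card_zero_positions[OF d(2)])
  with A Z show ?thesis by simp
qed

lemma card_resetting_set_cutoff:
  assumes s: "2 \<le> s" and d: "1 \<le> d" "d \<le> r"
  shows "real (card (resetting_set s d \<inter> {..<cutoff s r}))
    = (real (cutoff s r) - real (cutoff s d)) / real s ^ d"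
  using d(2)
proof (induction r rule: nat_induct_at_least)
  case base
  have "resetting_set s d \<inter> {..<cutoff s d} = {}"
    using resetting_set_ge_cutoff[OF s] by fastforce
  then show ?case by simp
next
  case (Suc r)
  have "s ^ Suc (r ^ 2) dvd cutoff s (Suc r)"
    unfolding cutoff_def by (intro le_imp_power_dvd) (simp add: power2_eq_square)
  then have "real (card (zero_digits s (zero_positions d r) \<inter> {..<cutoff s (Suc r)}))
      = real (cutoff s (Suc r)) / real s ^ d"
    using card_zero_digits_multiple_real[OF _ zero_positions_subset[OF Suc.hyps]] s
    by (simp add: card_zero_positions[OF Suc.hyps])
  moreover have "cutoff s r \<le> cutoff s (Suc r)"
    using strict_mono_less_eq[OF strict_mono_cutoff[OF s]] by simp
  ultimately show ?case
    using card_resetting_set_step[OF s d(1) Suc.hyps, of "cutoff s (Suc r)"] Suc.IH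
    by (simp add: diff_divide_distrib)
qed

text \<open>The first error term comes from an incomplete period at the end, the second one from the
  missing blocks below \<open>cutoff s d\<close>.\<close>

lemma counting_ratio_resetting_set:
  assumes s: "2 \<le> s" and d: "1 \<le> d" "d \<le> r0" and N: "cutoff s r0 \<le> N"
  shows "\<bar>counting_ratio (resetting_set s d) N - 1 / real s ^ d\<bar>
    \<le> real s / real s ^ r0 + real (cutoff s d) / real N"
proof -
  let ?c = "real (card (resetting_set s d \<inter> {..<N}))"
  obtain r where r: "r0 \<le> r" "N \<in> block s r"
    using block_cover[OF s N] by blast
  then have dr: "d \<le> r" and N': "cutoff s r \<le> N" "N \<le> cutoff s (Suc r)"
    using d by (auto simp: block_def)
  have N_pos: "0 < N"
    using N le_cutoff[OF s, of r0] d by linarith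
  have "?c = real (card (zero_digits s (zero_positions d r) \<inter> {..<N})) - real (cutoff s d) / real s ^ d"
    using card_resetting_set_step[OF s d(1) dr N'] card_resetting_set_cutoff[OF s d(1) dr]
    by (simp add: diff_divide_distrib)
  moreover have "\<bar>real (card (zero_digits s (zero_positions d r) \<inter> {..<N})) - real N / real s ^ d\<bar>
      \<le> real s ^ Suc (r ^ 2)"
    using card_zero_digits_approx[OF _ zero_positions_subset[OF dr], of s N] s
    by (simp add: card_zero_positions[OF dr])
  moreover have "real (cutoff s d) / real s ^ d \<le> real (cutoff s d)" "0 \<le> real (cutoff s d) / real s ^ d"
    using s by (simp_all add: divide_le_eq mult_le_cancel_left1)
  ultimately have "\<bar>?c - real N / real s ^ d\<bar> \<le> real s ^ Suc (r ^ 2) + real (cutoff s d)"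
    by linarith
  then have "\<bar>?c - real N / real s ^ d\<bar> / real N \<le> (real s ^ Suc (r ^ 2) + real (cutoff s d)) / real N"
    by (intro divide_right_mono) auto
  moreover have "counting_ratio (resetting_set s d) N - 1 / real s ^ d
      = (?c - real N / real s ^ d) / real N"
    using N_pos by (simp add: counting_ratio_def atLeast0LessThan diff_divide_distrib)
  moreover have "real s ^ Suc (r ^ 2) / real N \<le> real s / real s ^ r0"
  proof -
    have "real s ^ Suc (r ^ 2) / real N \<le> real s ^ Suc (r ^ 2) / real (cutoff s r)"
      using N'(1) N_pos s by (intro divide_left_mono) (auto simp: cutoff_def)
    also have "\<dots> = real s / real s ^ r"
      using s by (simp add: cutoff_def power_add)
    also have "\<dots> \<le> real s / real s ^ r0"
      using r(1) s by (intro divide_left_mono power_increasing) auto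
    finally show ?thesis .
  qed
  ultimately show ?thesis
    by (simp add: add_divide_distrib abs_divide)
qed

lemma counting_ratio_resetting_set_tendsto:
  assumes s: "2 \<le> s" and d: "1 \<le> d"
  shows "counting_ratio (resetting_set s d) \<longlonglongrightarrow> 1 / real s ^ d"
proof (rule LIMSEQ_I)
  fix e :: real assume e: "0 < e"
  have "(\<lambda>r. real s * (1 / real s) ^ r) \<longlonglongrightarrow> real s * 0"
    using s by (intro tendsto_intros LIMSEQ_power_zero) simp
  then have "eventually (\<lambda>r. real s * (1 / real s) ^ r < e / 2) sequentially"
    using e by (intro order_tendstoD(2)[of _ "real s * 0"]) auto
  then have "eventually (\<lambda>r. d \<le> r \<and> real s * (1 / real s) ^ r < e / 2) sequentially"
    using eventually_ge_at_top[of d] by eventually_elim simp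
  then obtain r0 where r0: "d \<le> r0" "real s * (1 / real s) ^ r0 < e / 2"
    using eventually_happens' sequentially_bot by blast
  have r0': "real s / real s ^ r0 < e / 2"
    using r0(2) by (simp add: power_one_over)
  have "(\<lambda>N. real (cutoff s d) / real N) \<longlonglongrightarrow> 0"
    by (rule lim_const_over_n)
  then have "eventually (\<lambda>N. real (cutoff s d) / real N < e / 2) sequentially"
    using e by (intro order_tendstoD(2)) auto
  then have "eventually (\<lambda>N. norm (counting_ratio (resetting_set s d) N - 1 / real s ^ d) < e) sequentially"
    using eventually_ge_at_top[of "cutoff s r0"]
  proof eventually_elim
    case (elim N)
    then show ?case
      using counting_ratio_resetting_set[OF s d r0(1) elim(2)] r0'
      unfolding real_norm_def by linarith
  qed
  then show "\<exists>N0. \<forall>N\<ge>N0. norm (counting_ratio (resetting_set s d) N - 1 / real s ^ d) < e"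
    by (simp add: eventually_sequentially)
qed

section \<open>The upper density of the sumset\<close>

text \<open>Here \<open>Suc r\<close> is the index of a reset block. The residue of \<open>n\<close> modulo \<open>s ^ d\<close> is supplied by an
  element \<open>a\<close> at the very beginning of the preceding block, whose constrained positions are all
  at least \<open>d\<close> and hence leave the lowest \<open>d\<close> digits free.\<close>

lemma mem_sumset_after_reset:
  assumes s: "2 \<le> s" and d: "1 \<le> d" and r: "2 * d \<le> r" "Suc d dvd Suc r"
    and n: "2 * cutoff s (Suc r) \<le> n" "n < cutoff s (Suc (Suc r))"
  shows "n \<in> resetting_set s d + resetting_set s d"
proof -
  define t where "t = n mod s ^ d"
  define a where "a = t + cutoff s r"
  define b where "b = n - a"
  have dr: "d \<le> r" "d \<le> Suc r" using r(1) by simp_all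
  have not_dvd: "\<not> Suc d dvd r"
    using r(2) d dvd_diff_nat[of "Suc d" "Suc r" r] by auto
  have dvd_cutoff: "s ^ d dvd cutoff s r"
    unfolding cutoff_def using dr by (intro le_imp_power_dvd) simp
  have t: "t < s ^ d" using s by (simp add: t_def)
  have "t < cutoff s r"
    using t dvd_imp_le[OF dvd_cutoff] le_cutoff[OF s, of r] d dr by linarith
  moreover have "2 * cutoff s r \<le> cutoff s (Suc r)"
  proof -
    have "s \<le> s ^ (2 * r + 2)"
      using s by (intro self_le_power) auto
    then have "2 * cutoff s r \<le> s ^ (2 * r + 2) * cutoff s r"
      using s by (intro mult_right_mono) linarith+
    then show ?thesis by (simp add: cutoff_Suc mult.commute)
  qed
  ultimately have a_block: "a \<in> block s r"
    by (simp add: a_def block_def)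
  have "digit s p a = 0" if p: "p \<in> zero_positions d r" for p
  proof -
    obtain j where j: "p = j ^ 2" "r - d < j" "j \<le> r"
      using p not_dvd by (auto simp: zero_positions_def)
    have "p < Suc (r ^ 2)"
      using zero_positions_subset[OF dr(1)] p by blast
    moreover have "s ^ Suc (r ^ 2) dvd cutoff s r"
      unfolding cutoff_def using d dr by (intro le_imp_power_dvd) simp
    then obtain k where "cutoff s r = k * s ^ Suc (r ^ 2)"
      by (metis dvdE mult.commute)
    ultimately have "digit s p a = digit s p t"
      unfolding a_def by (metis digit_add_mult_power)
    also have "\<dots> = 0"
    proof (rule digit_eq_0_if_less)
      have "d \<le> j" using r(1) j(2) by linarith
      also have "j \<le> p" by (simp add: j(1) power2_eq_square)
      finally have "s ^ d \<le> s ^ p" using s by (intro power_increasing) auto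
      with t show "t < s ^ p" by linarith
    qed
    finally show ?thesis .
  qed
  then have a: "a \<in> resetting_set s d"
    using mem_resetting_set_block[OF s dr(1) a_block] by (simp add: zero_digits_def)
  have a_less: "a < cutoff s (Suc r)"
    using a_block by (simp add: block_def)
  then have b_block: "b \<in> block s (Suc r)"
    using n by (auto simp: b_def block_def)
  have "b = (n - t) - cutoff s r"
    by (simp add: b_def a_def)
  also have "s ^ d dvd \<dots>"
    unfolding t_def by (intro dvd_diff_nat dvd_cutoff dvd_minus_mod)
  finally have "s ^ d dvd b" .
  then have "b \<in> zero_digits s (zero_positions d (Suc r))"
    using r(2) by (auto simp: zero_digits_def zero_positions_def intro: digit_eq_0_if_dvd)
  then have b: "b \<in> resetting_set s d"
    using mem_resetting_set_block[OF s dr(2) b_block] by simp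
  have "n = a + b"
    using n a_less by (simp add: b_def)
  with a b show ?thesis
    by (simp add: set_plus_intro)
qed

lemma upper_dens_sumset_resetting_set:
  assumes s: "2 \<le> s" and d: "1 \<le> d"
  shows "1 / 2 \<le> upper_dens (resetting_set s d + resetting_set s d)"
proof (rule le_upper_dens)
  fix n
  let ?S = "resetting_set s d + resetting_set s d"
  \<comment> \<open>The factor \<open>n + 2\<close> ensures \<open>r \<ge> 2 * d\<close> even for \<open>n = 0\<close>.\<close>
  define r where "r = (n + 2) * Suc d - 1"
  have Suc_r: "Suc r = (n + 2) * Suc d"
    by (simp add: r_def)
  have r: "2 * d \<le> r" "Suc d dvd Suc r" "n \<le> Suc r"
    unfolding Suc_r by (simp add: r_def, rule dvd_triv_right, simp)
  define M where "M = cutoff s (Suc r)"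
  define N where "N = cutoff s (Suc (Suc r))"
  have "(2::nat) ^ 2 \<le> s ^ 2"
    using s by (intro power_mono) auto
  also have "\<dots> \<le> s ^ (2 * Suc r + 2)"
    using s by (intro power_increasing) auto
  finally have M: "4 * M \<le> N"
    by (simp add: M_def N_def cutoff_Suc[of s "Suc r"] mult.commute)
  have "{2 * M..<N} \<subseteq> ?S \<inter> {0..<N}"
    using mem_sumset_after_reset[OF s d r(1,2)] by (auto simp: M_def N_def)
  then have "N - 2 * M \<le> card (?S \<inter> {0..<N})"
    using card_mono[of "?S \<inter> {0..<N}" "{2 * M..<N}"] by simp
  then have "real N / 2 \<le> real (card (?S \<inter> {0..<N}))"
    using M by linarith
  moreover have "n \<le> N" "0 < N"
    using le_cutoff[OF s, of "Suc (Suc r)"] r(3) by (simp_all add: N_def)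
  ultimately show "\<exists>N\<ge>n. 1 / 2 \<le> counting_ratio ?S N"
    by (intro exI[of _ N]) (simp add: counting_ratio_def field_simps)
qed

section \<open>The lower density of the sumset\<close>

text \<open>The exceptional position for an element of block \<open>r\<close> is \<open>(r + 1)\<^sup>2\<close>, or \<open>(R + 1)\<^sup>2\<close> for an element
  of any block up to the reset block \<open>R\<close>.\<close>

lemma card_nonzero_digits_le_1:
  assumes s: "2 \<le> s" and R: "Suc d dvd R"
    and a: "a \<in> resetting_set s d" "a < cutoff s (Suc (R + d))"
  shows "card {p \<in> (\<lambda>j. j ^ 2) ` {R<..R + d}. digit s p a \<noteq> 0} \<le> 1"
proof -
  obtain r where r: "d \<le> r" "a \<in> block s r" "a \<in> zero_digits s (zero_positions d r)"
    using a(1) by (auto simp: resetting_set_def)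
  have "cutoff s r < cutoff s (Suc (R + d))"
    using r(2) a(2) by (simp add: block_def)
  then have r_le: "r \<le> R + d"
    using strict_mono_less[OF strict_mono_cutoff[OF s]] by simp
  have zero: "digit s (j ^ 2) a = 0" if j: "R < j" "j \<le> R + d" "j \<noteq> Suc (max R r)" for j
  proof (cases "j \<le> max R r")
    \<comment> \<open>\<open>R < j \<le> r \<le> R + d\<close>: block \<open>r\<close> is ordinary and constrains the position \<open>j\<^sup>2\<close>.\<close>
    case True
    with j have "R < r" "j \<le> r" by auto
    have "\<not> Suc d dvd r"
    proof
      assume "Suc d dvd r"
      then have "Suc d dvd r - R" using R by (rule dvd_diff_nat)
      with \<open>R < r\<close> r_le show False by (auto dest: dvd_imp_le)
    qed
    then have "j ^ 2 \<in> zero_positions d r"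
      using j r_le \<open>j \<le> r\<close> by (auto simp: zero_positions_def)
    with r(3) show ?thesis by (simp add: zero_digits_def)
  next
    \<comment> \<open>\<open>j \<ge> r + 2\<close>: the number \<open>a\<close> is too short to have a digit at the position \<open>j\<^sup>2\<close>.\<close>
    case False
    with j have "Suc (Suc r) \<le> j" by auto
    then have "(Suc (Suc r)) ^ 2 \<le> j ^ 2" by (rule power_mono) simp
    then have "(Suc r) ^ 2 + Suc r \<le> j ^ 2" by (simp add: power2_eq_square)
    then have "cutoff s (Suc r) \<le> s ^ j ^ 2"
      unfolding cutoff_def using s by (intro power_increasing) auto
    with r(2) show ?thesis
      by (intro digit_eq_0_if_less) (simp add: block_def)
  qed
  have "{p \<in> (\<lambda>j. j ^ 2) ` {R<..R + d}. digit s p a \<noteq> 0} \<subseteq> {(Suc (max R r)) ^ 2}"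
  proof
    fix p assume "p \<in> {p \<in> (\<lambda>j. j ^ 2) ` {R<..R + d}. digit s p a \<noteq> 0}"
    then obtain j where j: "p = j ^ 2" "R < j" "j \<le> R + d" "digit s (j ^ 2) a \<noteq> 0"
      by auto
    with zero have "j = Suc (max R r)" by metis
    with j(1) show "p \<in> {(Suc (max R r)) ^ 2}" by simp
  qed
  then show ?thesis
    using card_mono[of "{(Suc (max R r)) ^ 2}"] by fastforce
qed

lemma lower_dens_sumset_resetting_set:
  assumes s: "2 \<le> s"
  shows "lower_dens (resetting_set s d + resetting_set s d) \<le> real s ^ 2 * (3 / real s) ^ d"
proof (rule lower_dens_le)
  fix n
  let ?S = "resetting_set s d + resetting_set s d"
  define R where "R = n * Suc d"
  have dvd_R: "Suc d dvd R" unfolding R_def by (rule dvd_triv_right)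
  define I where "I = (\<lambda>j::nat. j ^ 2) ` {R<..R + d}"
  define L where "L = (Suc (R + d)) ^ 2 + Suc (R + d)"
  have N: "s ^ L = cutoff s (Suc (R + d))"
    by (simp add: L_def cutoff_def)
  have card_I: "card I = d"
    by (simp add: I_def card_image inj_on_def)
  have "j ^ 2 < L" if "j \<le> R + d" for j
    using power_mono[OF that, of 2] by (simp add: L_def power2_eq_square)
  then have I: "I \<subseteq> {..<L}"
    by (auto simp: I_def)
  have "?S \<inter> {0..<s ^ L} \<subseteq> {x \<in> {..<s ^ L}. card {p \<in> I. 1 < digit s p x} \<le> 2}"
  proof
    fix x assume x: "x \<in> ?S \<inter> {0..<s ^ L}"
    then obtain a b where ab: "a \<in> resetting_set s d" "b \<in> resetting_set s d" "x = a + b"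
      by (auto elim: set_plus_elim)
    let ?Z = "\<lambda>a. {p \<in> I. digit s p a \<noteq> 0}"
    have "a < cutoff s (Suc (R + d))" "b < cutoff s (Suc (R + d))"
      using x ab(3) by (simp_all flip: N)
    then have "card (?Z a) \<le> 1" "card (?Z b) \<le> 1"
      unfolding I_def using ab card_nonzero_digits_le_1[OF s dvd_R] by blast+
    then have "card (?Z a \<union> ?Z b) \<le> 2"
      using card_Un_le[of "?Z a" "?Z b"] by linarith
    moreover have "{p \<in> I. 1 < digit s p x} \<subseteq> ?Z a \<union> ?Z b"
      using digit_add_le_1[of s _ a b] s ab(3) by fastforce
    then have "card {p \<in> I. 1 < digit s p x} \<le> card (?Z a \<union> ?Z b)"
      by (intro card_mono) (auto simp: I_def)
    ultimately show "x \<in> {x \<in> {..<s ^ L}. card {p \<in> I. 1 < digit s p x} \<le> 2}"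
      using x by simp
  qed
  then have "card (?S \<inter> {0..<s ^ L}) \<le> card {x \<in> {..<s ^ L}. card {p \<in> I. 1 < digit s p x} \<le> 2}"
    by (intro card_mono) auto
  also have "real \<dots> \<le> real s ^ 2 * (3 / real s) ^ d * real s ^ L"
    using card_few_large_digits[OF _ I, of s] s by (simp add: card_I)
  finally have "counting_ratio ?S (s ^ L) \<le> real s ^ 2 * (3 / real s) ^ d"
    using s by (simp add: counting_ratio_def divide_le_eq)
  moreover have "n \<le> s ^ L"
    using le_cutoff[OF s, of "Suc (R + d)"] by (simp add: N R_def)
  ultimately show "\<exists>N\<ge>n. counting_ratio ?S N \<le> real s ^ 2 * (3 / real s) ^ d"
    by blast
qed

section \<open>Failure of the inequality\<close>

theorem corollary1p3:
  shows "\<not> (\<exists>\<nu> c :: real. 0 < \<nu> \<and> \<nu> < 1 \<and> c > 0 \<and>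
    (\<forall>A :: nat set. admits_dens A \<longrightarrow>
      lower_dens (A + A) \<ge> c * upper_dens (A + A) powr (1 - \<nu>) * asymp_dens A powr \<nu>))"
proof
  assume "\<exists>\<nu> c :: real. 0 < \<nu> \<and> \<nu> < 1 \<and> c > 0 \<and>
    (\<forall>A :: nat set. admits_dens A \<longrightarrow>
      lower_dens (A + A) \<ge> c * upper_dens (A + A) powr (1 - \<nu>) * asymp_dens A powr \<nu>)"
  then obtain \<nu> c :: real where \<nu>: "0 < \<nu>" "\<nu> < 1" and c: "0 < c"
    and ineq: "\<And>A :: nat set. admits_dens A \<Longrightarrow>
      lower_dens (A + A) \<ge> c * upper_dens (A + A) powr (1 - \<nu>) * asymp_dens A powr \<nu>"
    by blast
  obtain s :: nat where s: "2 \<le> s" "6 \<le> real s powr (1 - \<nu>)"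
  proof -
    obtain s :: nat where s: "max 2 (6 powr (1 / (1 - \<nu>))) \<le> real s"
      using real_arch_simple by blast
    have "6 = (6 powr (1 / (1 - \<nu>))) powr (1 - \<nu>)"
      using \<nu> by (simp add: powr_powr)
    also have "\<dots> \<le> real s powr (1 - \<nu>)"
      using s \<nu> by (intro powr_mono2) auto
    finally show ?thesis using s by (intro that) auto
  qed
  obtain d0 where d0: "2 * real s ^ 2 / c < 2 ^ d0"
    using real_arch_pow[of 2] by auto
  define d where "d = Suc d0"
  have "(2::real) ^ d0 \<le> 2 ^ d" by (simp add: d_def)
  with d0 have d: "1 \<le> d" "2 * real s ^ 2 / c < 2 ^ d"
    by (simp add: d_def, linarith)
  define A where "A = resetting_set s d"
  define q where "q = real s ^ d"
  have q: "0 < q" using s by (simp add: q_def)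
  have dens: "lower_dens A = 1 / q" "upper_dens A = 1 / q"
    using dens_eq_if_tendsto[OF counting_ratio_resetting_set_tendsto[OF s(1) d(1)]]
    by (simp_all add: A_def q_def)
  then have adm: "admits_dens A"
    by (simp add: admits_dens_def)
  have "(1 / 2 :: real) = (1 / 2) powr 1" by simp
  also have "\<dots> \<le> (1 / 2) powr (1 - \<nu>)"
    using \<nu> by (intro powr_mono') auto
  also have "\<dots> \<le> upper_dens (A + A) powr (1 - \<nu>)"
    using upper_dens_sumset_resetting_set[OF s(1) d(1)] \<nu> by (intro powr_mono2) (auto simp: A_def)
  finally have "c * (1 / 2) * (1 / q) powr \<nu> \<le> c * upper_dens (A + A) powr (1 - \<nu>) * asymp_dens A powr \<nu>"
    using c by (intro mult_mono) (simp_all add: asymp_dens_eq[OF adm] dens)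
  also have "\<dots> \<le> lower_dens (A + A)"
    by (rule ineq[OF adm])
  also have "\<dots> \<le> real s ^ 2 * (3 ^ d / q)"
    using lower_dens_sumset_resetting_set[OF s(1), of d] by (simp add: A_def q_def power_divide)
  finally have "c / 2 * ((1 / q) powr \<nu> * q) \<le> real s ^ 2 * 3 ^ d"
    using q by (simp add: field_simps)
  moreover have "(1 / q) powr \<nu> * q = (real s powr (1 - \<nu>)) ^ d"
  proof -
    have "(1 / q) powr \<nu> * q = q powr (1 - \<nu>)"
      using q by (simp add: powr_diff powr_divide)
    also have "\<dots> = (real s powr (1 - \<nu>)) ^ d"
      using s(1) by (simp add: q_def powr_power powr_powr mult.commute flip: powr_realpow)
    finally show ?thesis .
  qed
  moreover have "6 ^ d \<le> (real s powr (1 - \<nu>)) ^ d"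
    using s(2) by (intro power_mono) auto
  ultimately have "c / 2 * 6 ^ d \<le> real s ^ 2 * 3 ^ d"
    using c by (smt (verit) mult_left_mono divide_pos_pos)
  moreover have "(6::real) ^ d = 2 ^ d * 3 ^ d"
    by (simp flip: power_mult_distrib)
  ultimately have "c / 2 * 2 ^ d \<le> real s ^ 2"
    by simp
  with d(2) c show False
    by (simp add: field_simps)
qed

end
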